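(* Let $(G,F)$ be a similarity GIFS with $\lambda(f_e)=s^{d(e)}$ for all $e\in E$. If $(G,F)$ satisfies the triangle property, then the balanced tiling $T(\overleftarrow{\theta})$ is repetitive for all filling parameters $\overleftarrow{\theta}\in\overleftarrow{\Sigma}^\infty$.
   Context: GIFS. Let $G=(V,E)$ be a finite strongly connected directed graph with $V=\{1,\dots,n\}$, loops and multiple edges allowed. An edge $e$ goes from its tail $e^-$ to its head $e^+$, and $E_i=\{e\in E: e^-=i\}$. A path is directed, is written as its string of edges, may repeat vertices and edges, and may have length zero (a single vertex); $\sigma^-$ is its starting vertex and, for finite $\sigma$, $\sigma^+$ is its terminal vertex. $\Sigma^*$ is the set of finite paths in $G$. A GIFS $(G,F)$ on $\mathbb{R}^d$ consists of $G$ and an invertible contraction $f_e:\mathbb{R}^d\to\mathbb{R}^d$ for each $e\in E$. For $\sigma=\sigma_1\cdots\sigma_k\in\Sigma^*$ put $f_\sigma=f_{\sigma_1}\circ\cdots\circ f_{\sigma_k}$ (the identity if $k=0$). There is a unique $n$-tuple $(A_1,\dots,A_n)$ of nonempty compact sets (the components of the attractor) with $A_i=\bigcup_{e\in E_i}f_e(A_{e^+})$ for all $i$. Standing assumptions: each $A_i$ has nonempty interior, and for each $i$ and distinct $e,e'\in E_i$ the set $f_e(A_{e^+})\cap f_{e'}(A_{e'^+})$ has empty interior. Tilings. A tile is a compact subset of $\mathbb{R}^d$ with nonempty interior; a tiling of $X\subseteq\mathbb{R}^d$ is a set of tiles, pairwise non-overlapping (the intersection of two distinct tiles has empty interior), whose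 union is $X$. A tiling $T$ of $\mathbb{R}^d$ is repetitive if for every finite patch $P$ of $T$ (finite set of tiles of $T$) there is a real number $R$ such that every ball of radius $R$ contains a patch of $T$ isometric (congruent) to $P$. Pre-trees. A subpath of $\sigma_1\cdots\sigma_k$ is an initial segment $\sigma_1\cdots\sigma_j$ with $0\le j\le k$ (for $j=0$, the single starting vertex); it is proper if $j<k$. A pre-tree is a finite nonempty set $S$ of finite paths in $G$ such that (i) all paths in $S$ begin at the same vertex, the root of $S$; (ii) no proper subpath of a path in $S$ lies in $S$; (iii) if $\sigma$ is a proper subpath of a path in $S$ and $e\in E$ has $e^-=\sigma^+$, then $\sigma e$ is a subpath of a path in $S$. Parameters. Let $\overleftarrow{G}$ be $G$ with all edges reversed, $\overleftarrow{e}$ the reversal of $e$, $\overleftarrow{\Sigma}^*$ and $\overleftarrow{\Sigma}^\infty$ the sets of finite and infinite paths in $\overleftarrow{G}$, $f_{\overleftarrow{e}}=f_e^{-1}$, and $f_{\overleftarrow{e_1}\cdots\overleftarrow{e_k}}=f_{\overleftarrow{e_1}}\circ\cdots\circ f_{\overleftarrow{e_k}}$. A parameter is an element $\overleftarrow{\theta}=\overleftarrow{\theta}_1\overleftarrow{\theta}_2\cdots$ of $\overleftarrow{\Sigma}^\infty$, with successive vertices $v_0,v_1,v_2,\dots$; $\theta_k\in E$ is the edge of $G$ with reversal $\overleftarrow{\theta}_k$ (so $\theta_k$ goes from $v_k$ to $v_{k-1}$), and $\overleftarrow{\theta}|k=\overleftarrow{\theta}_1\cdots\overleftarrow{\theta}_k$.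 A $\overleftarrow{\theta}$-sequence is a sequence $\mathcal{S}=\{S_0,S_1,\dots\}$ of pre-trees such that $S_k$ has root $v_k$ for all $k\ge0$ and $\theta_kS_{k-1}:=\{\theta_k\sigma:\sigma\in S_{k-1}\}\subset S_k$ for all $k\ge1$. Put $T(\overleftarrow{\theta},\mathcal{S},k)=\{f_{\overleftarrow{\theta}|k}\circ f_\sigma(A_{\sigma^+}):\sigma\in S_k\}$ and $T(\overleftarrow{\theta},\mathcal{S})=\bigcup_{k\ge0}T(\overleftarrow{\theta},\mathcal{S},k)$. The parameter $\overleftarrow{\theta}$ is filling if, for every $\overleftarrow{\theta}$-sequence $\mathcal{S}$, the union of the sets in $T(\overleftarrow{\theta},\mathcal{S})$ is $\mathbb{R}^d$. Balanced tilings. Each $f_e$ is a similarity with scaling ratio $\lambda(f_e)$, and there are a fixed real $s>0$ (the scaling constant) and fixed positive integers $d(e)$ with $\lambda(f_e)=s^{d(e)}$ for all $e\in E$. Put $d(\overleftarrow{e})=d(e)$; for a finite path $\sigma$ in $G$ or $\overleftarrow{G}$, $d(\sigma)$ is the sum of the values $d(e)$ over its edges (with multiplicity), and $\sigma_*$ is the last edge of a path $\sigma\in\Sigma^*$ of positive length. The balanced sequence $\mathcal{S}(\overleftarrow{\theta})=(S_0,S_1,\dots)$ has $S_k$ equal to the set of positive-length $\sigma\in\Sigma^*$ with $\sigma^-=v_k$ and $0<d(\sigma)-d(\overleftarrow{\theta}|k)\le d(\sigma_* )$. For filling $\overleftarrow{\theta}$, the balanced GIFS tiling is $T(\overleftarrow{\theta}):=T(\overleftarrow{\theta},\mathcal{S}(\overleftarrow{\theta}))$.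 Triangle property. $(G,F)$ satisfies the triangle property if there is an integer $N$ such that for all $u,v,w\in V$, if $\sigma(u,v)$ is a path from $u$ to $v$ and $\sigma(u,w)$ is a path from $u$ to $w$ with $d(\sigma(u,v))-d(\sigma(u,w))\ge N$, then there is a path $\sigma(w,v)$ from $w$ to $v$ with $d(\sigma(u,v))=d(\sigma(u,w))+d(\sigma(w,v))$. *)

theory Defs
  imports "HOL-Analysis.Analysis" "HOL-Library.Sublist" "Graph_Theory.Digraph_Component"
begin

section \<open>Paths in directed multigraphs\<close>

text \<open>
  A finite path is given by its starting vertex \<open>v\<close> together with its list \<open>\<sigma>\<close> of edges; the
  starting vertex is always supplied separately, so that \<open>[]\<close> is the path of length zero at \<open>v\<close>.
  The terminal vertex is \<open>pre_digraph.awlast G v \<sigma>\<close>.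
\<close>

definition paths_from :: "('v, 'e) pre_digraph \<Rightarrow> 'v \<Rightarrow> 'e list set" where
  "paths_from G v = {\<sigma>. \<exists>w. pre_digraph.awalk G v \<sigma> w}"

text \<open>The reversal of an edge is represented by the edge itself, regarded as an edge of the
  reversed graph.\<close>

definition reverse_graph :: "('v, 'e) pre_digraph \<Rightarrow> ('v, 'e) pre_digraph" where
  "reverse_graph G = \<lparr>verts = verts G, arcs = arcs G, tail = head G, head = tail G\<rparr>"

definition infinite_path :: "('v, 'e) pre_digraph \<Rightarrow> (nat \<Rightarrow> 'e) \<Rightarrow> bool" where
  "infinite_path H \<theta> \<longleftrightarrow> (\<forall>k. \<theta> k \<in> arcs H \<and> head H (\<theta> k) = tail H (\<theta> (Suc k)))"

definition path_weight :: "('e \<Rightarrow> nat) \<Rightarrow> 'e list \<Rightarrow> nat" where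
  "path_weight d \<sigma> = sum_list (map d \<sigma>)"

definition path_map :: "('e \<Rightarrow> 'a \<Rightarrow> 'a) \<Rightarrow> 'e list \<Rightarrow> 'a \<Rightarrow> 'a" where
  "path_map f \<sigma> = foldr (\<lambda>e g. f e \<circ> g) \<sigma> id"


section \<open>Graph-directed iterated function systems\<close>

definition contraction :: "('a::metric_space \<Rightarrow> 'a) \<Rightarrow> bool" where
  "contraction g \<longleftrightarrow> (\<exists>c<1. c-lipschitz_on UNIV g)"

definition similarity :: "real \<Rightarrow> ('a::metric_space \<Rightarrow> 'a) \<Rightarrow> bool" where
  "similarity r g \<longleftrightarrow> 0 < r \<and> (\<forall>x y. dist (g x) (g y) = r * dist x y)"

definition gifs :: "('v, 'e) pre_digraph \<Rightarrow> ('e \<Rightarrow> (real ^ 'n) \<Rightarrow> (real ^ 'n)) \<Rightarrow> bool" where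
  "gifs G f \<longleftrightarrow> fin_digraph G \<and> strongly_connected G \<and>
     (\<forall>e\<in>arcs G. bij (f e) \<and> contraction (f e))"

text \<open>The components of the attractor, as a family indexed by the vertices; the values of \<open>A\<close>
  at vertices of \<open>G\<close> are determined uniquely by this predicate whenever \<open>gifs G f\<close> holds.\<close>

definition attractor ::
  "('v, 'e) pre_digraph \<Rightarrow> ('e \<Rightarrow> (real ^ 'n) \<Rightarrow> (real ^ 'n)) \<Rightarrow> ('v \<Rightarrow> (real ^ 'n) set) \<Rightarrow> bool" where
  "attractor G f A \<longleftrightarrow> (\<forall>i\<in>verts G. A i \<noteq> {} \<and> compact (A i) \<and>
     A i = (\<Union>e\<in>out_arcs G i. f e ` A (head G e)))"

definition nonoverlapping_attractor ::
  "('v, 'e) pre_digraph \<Rightarrow> ('e \<Rightarrow> (real ^ 'n) \<Rightarrow> (real ^ 'n)) \<Rightarrow> ('v \<Rightarrow> (real ^ 'n) set) \<Rightarrow> bool" where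
  "nonoverlapping_attractor G f A \<longleftrightarrow> (\<forall>i\<in>verts G. interior (A i) \<noteq> {} \<and>
     (\<forall>e\<in>out_arcs G i. \<forall>e'\<in>out_arcs G i. e \<noteq> e' \<longrightarrow>
        interior (f e ` A (head G e) \<inter> f e' ` A (head G e')) = {}))"

definition similarity_gifs ::
  "('v, 'e) pre_digraph \<Rightarrow> ('e \<Rightarrow> (real ^ 'n) \<Rightarrow> (real ^ 'n)) \<Rightarrow> real \<Rightarrow> ('e \<Rightarrow> nat) \<Rightarrow> bool" where
  "similarity_gifs G f s d \<longleftrightarrow> gifs G f \<and> 0 < s \<and>
     (\<forall>e\<in>arcs G. 0 < d e \<and> similarity (s ^ d e) (f e))"

definition triangle_property :: "('v, 'e) pre_digraph \<Rightarrow> ('e \<Rightarrow> nat) \<Rightarrow> bool" where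
  "triangle_property G d \<longleftrightarrow> (\<exists>N::int. \<forall>u\<in>verts G. \<forall>v\<in>verts G. \<forall>w\<in>verts G. \<forall>p q.
     pre_digraph.awalk G u p v \<and> pre_digraph.awalk G u q w \<and>
     int (path_weight d p) - int (path_weight d q) \<ge> N \<longrightarrow>
     (\<exists>r. pre_digraph.awalk G w r v \<and> path_weight d p = path_weight d q + path_weight d r))"


section \<open>Tilings\<close>

definition tile :: "(real ^ 'n) set \<Rightarrow> bool" where
  "tile t \<longleftrightarrow> compact t \<and> interior t \<noteq> {}"

definition tiling :: "(real ^ 'n) set \<Rightarrow> (real ^ 'n) set set \<Rightarrow> bool" where
  "tiling X T \<longleftrightarrow> (\<forall>t\<in>T. tile t) \<and>
     (\<forall>t\<in>T. \<forall>t'\<in>T. t \<noteq> t' \<longrightarrow> interior (t \<inter> t') = {}) \<and> \<Union>T = X"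

definition isometric_patches :: "(real ^ 'n) set set \<Rightarrow> (real ^ 'n) set set \<Rightarrow> bool" where
  "isometric_patches P Q \<longleftrightarrow>
     (\<exists>\<phi>. bij \<phi> \<and> (\<forall>x y. dist (\<phi> x) (\<phi> y) = dist x y) \<and> Q = (\<lambda>t. \<phi> ` t) ` P)"

definition repetitive :: "(real ^ 'n) set set \<Rightarrow> bool" where
  "repetitive T \<longleftrightarrow> tiling UNIV T \<and>
     (\<forall>P. finite P \<and> P \<subseteq> T \<longrightarrow>
        (\<exists>R>0. \<forall>x. \<exists>Q\<subseteq>T. isometric_patches P Q \<and> \<Union>Q \<subseteq> ball x R))"


section \<open>Parameters and the tilings they generate\<close>

text \<open>Sequences are indexed from zero: \<open>\<theta> k\<close> is the edge usually written \<open>\<theta>\<close> with subscript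
  \<open>k + 1\<close>. In \<open>G\<close> it leads from the vertex number \<open>k + 1\<close> of the parameter to the vertex
  number \<open>k\<close>.\<close>

definition parameter :: "('v, 'e) pre_digraph \<Rightarrow> (nat \<Rightarrow> 'e) \<Rightarrow> bool" where
  "parameter G \<theta> \<longleftrightarrow> infinite_path (reverse_graph G) \<theta>"

definition param_vertex :: "('v, 'e) pre_digraph \<Rightarrow> (nat \<Rightarrow> 'e) \<Rightarrow> nat \<Rightarrow> 'v" where
  "param_vertex G \<theta> k = tail (reverse_graph G) (\<theta> k)"

definition initial_part :: "(nat \<Rightarrow> 'e) \<Rightarrow> nat \<Rightarrow> 'e list" where
  "initial_part \<theta> k = map \<theta> [0..<k]"

definition pre_tree :: "('v, 'e) pre_digraph \<Rightarrow> 'v \<Rightarrow> 'e list set \<Rightarrow> bool" where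
  "pre_tree G v S \<longleftrightarrow> finite S \<and> S \<noteq> {} \<and> S \<subseteq> paths_from G v \<and>
     (\<forall>\<sigma>\<in>S. \<forall>\<tau>. strict_prefix \<tau> \<sigma> \<longrightarrow> \<tau> \<notin> S) \<and>
     (\<forall>\<sigma>\<in>S. \<forall>\<tau> e. strict_prefix \<tau> \<sigma> \<and> e \<in> out_arcs G (pre_digraph.awlast G v \<tau>) \<longrightarrow>
        (\<exists>\<rho>\<in>S. prefix (\<tau> @ [e]) \<rho>))"

definition theta_sequence ::
  "('v, 'e) pre_digraph \<Rightarrow> (nat \<Rightarrow> 'e) \<Rightarrow> (nat \<Rightarrow> 'e list set) \<Rightarrow> bool" where
  "theta_sequence G \<theta> S \<longleftrightarrow> (\<forall>k. pre_tree G (param_vertex G \<theta> k) (S k)) \<and>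
     (\<forall>k. (\<lambda>\<sigma>. \<theta> k # \<sigma>) ` S k \<subseteq> S (Suc k))"

definition level_tiling ::
  "('v, 'e) pre_digraph \<Rightarrow> ('e \<Rightarrow> (real ^ 'n) \<Rightarrow> (real ^ 'n)) \<Rightarrow> ('v \<Rightarrow> (real ^ 'n) set) \<Rightarrow>
     (nat \<Rightarrow> 'e) \<Rightarrow> (nat \<Rightarrow> 'e list set) \<Rightarrow> nat \<Rightarrow> (real ^ 'n) set set" where
  "level_tiling G f A \<theta> S k =
     (\<lambda>\<sigma>. (path_map (\<lambda>e. inv (f e)) (initial_part \<theta> k) \<circ> path_map f \<sigma>) `
             A (pre_digraph.awlast G (param_vertex G \<theta> k) \<sigma>)) ` S k"

definition gifs_tiling ::
  "('v, 'e) pre_digraph \<Rightarrow> ('e \<Rightarrow> (real ^ 'n) \<Rightarrow> (real ^ 'n)) \<Rightarrow> ('v \<Rightarrow> (real ^ 'n) set) \<Rightarrow>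
     (nat \<Rightarrow> 'e) \<Rightarrow> (nat \<Rightarrow> 'e list set) \<Rightarrow> (real ^ 'n) set set" where
  "gifs_tiling G f A \<theta> S = (\<Union>k. level_tiling G f A \<theta> S k)"

definition filling ::
  "('v, 'e) pre_digraph \<Rightarrow> ('e \<Rightarrow> (real ^ 'n) \<Rightarrow> (real ^ 'n)) \<Rightarrow> ('v \<Rightarrow> (real ^ 'n) set) \<Rightarrow>
     (nat \<Rightarrow> 'e) \<Rightarrow> bool" where
  "filling G f A \<theta> \<longleftrightarrow> (\<forall>S. theta_sequence G \<theta> S \<longrightarrow> \<Union>(gifs_tiling G f A \<theta> S) = UNIV)"

definition balanced_sequence ::
  "('v, 'e) pre_digraph \<Rightarrow> ('e \<Rightarrow> nat) \<Rightarrow> (nat \<Rightarrow> 'e) \<Rightarrow> nat \<Rightarrow> 'e list set" where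
  "balanced_sequence G d \<theta> k =
     {\<sigma> \<in> paths_from G (param_vertex G \<theta> k). \<sigma> \<noteq> [] \<and>
        0 < int (path_weight d \<sigma>) - int (path_weight d (initial_part \<theta> k)) \<and>
        int (path_weight d \<sigma>) - int (path_weight d (initial_part \<theta> k)) \<le> int (d (last \<sigma>))}"

definition balanced_tiling ::
  "('v, 'e) pre_digraph \<Rightarrow> ('e \<Rightarrow> (real ^ 'n) \<Rightarrow> (real ^ 'n)) \<Rightarrow> ('v \<Rightarrow> (real ^ 'n) set) \<Rightarrow>
     ('e \<Rightarrow> nat) \<Rightarrow> (nat \<Rightarrow> 'e) \<Rightarrow> (real ^ 'n) set set" where
  "balanced_tiling G f A d \<theta> = gifs_tiling G f A \<theta> (balanced_sequence G d \<theta>)"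

end

theory Submission
  imports Defs
begin

text \<open>
  A path of weight \<open>m\<close> contracts by exactly \<open>s ^ m\<close>. For a vertex \<open>v\<close> and a number \<open>m\<close>, consider the
  paths from \<open>v\<close> that are cut off at the first edge by which their weight exceeds \<open>m\<close>
  (\<open>weight_cut v m\<close>); they subdivide the component \<open>A v\<close> into tiles (\<open>subdivision v m\<close>). If
  \<open>v\<^sub>k\<close> is the \<open>k\<close>-th vertex of the parameter \<open>\<theta>\<close> and \<open>D\<^sub>k\<close> is the weight of its first \<open>k\<close> edges,
  then the \<open>k\<close>-th level of the balanced tiling is the subdivision of \<open>A v\<^sub>k\<close> at weight \<open>D\<^sub>k\<close>, blown
  up by a similarity \<open>g\<^sub>k\<close> of ratio \<open>s\<close> to the power \<open>- D\<^sub>k\<close>.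

  Cutting is compatible with concatenation (\<open>weight_cut_append_iff\<close>): the members of
  \<open>weight_cut v m\<close> that extend a path \<open>\<tau>\<close> from \<open>v\<close> to \<open>w\<close> of weight at most \<open>m\<close> are the paths
  \<open>\<tau> @ \<rho>\<close> with \<open>\<rho>\<close> in the cut of \<open>w\<close> at the remaining weight. Hence \<open>f\<^sub>\<tau>\<close> carries a subdivision of
  \<open>A w\<close> into that of \<open>A v\<close> (\<open>subdivision_refines\<close>). With \<open>\<tau>\<close> a single edge of the parameter, this
  shows that the levels increase. They form a tiling: distinct paths of a cut part at some vertex,
  where the two edges taken have non-overlapping images, and the cuts are pre-trees, so that the
  filling property gives all of the space.

  For repetitivity, a finite patch lies in some level \<open>k\<close>, and it suffices to find a copy of the whole
  level \<open>k\<close> at a bounded distance from any point \<open>x\<close>. Choose a constant \<open>M\<close>, depending only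
  on \<open>k\<close> and on the threshold in the triangle property, and a level \<open>K\<close> large enough that \<open>D\<^sub>K \<ge> M\<close> and that a tile of level \<open>K\<close>, given by a path \<open>\<sigma>\<close>,
  contains \<open>x\<close>. Stop \<open>\<sigma>\<close> about \<open>M\<close> units of weight before \<open>D\<^sub>K\<close>, at an initial segment \<open>\<tau>\<close> ending in
  \<open>w\<close>. The set \<open>g\<^sub>K (f\<^sub>\<tau> (A w))\<close> contains \<open>x\<close>, and its diameter is bounded in terms of \<open>M\<close> alone. The
  parameter, run backwards, gives a path from \<open>v\<^sub>K\<close> to \<open>v\<^sub>k\<close> of weight \<open>D\<^sub>K - D\<^sub>k\<close>. As \<open>M\<close> is large, the
  triangle property yields a path \<open>\<rho>\<close> from \<open>w\<close> to \<open>v\<^sub>k\<close> for which \<open>\<tau> @ \<rho>\<close> has the same weight. Then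
  \<open>g\<^sub>K \<circ> f\<^sub>\<tau> \<circ> f\<^sub>\<rho>\<close> has the same ratio as \<open>g\<^sub>k\<close>, and it carries the subdivision that makes up level \<open>k\<close>
  to an isometric copy of level \<open>k\<close> inside level \<open>K\<close> and inside \<open>g\<^sub>K (f\<^sub>\<tau> (A w))\<close>
  (\<open>repeated_level\<close>).
\<close>

section \<open>Similarities\<close>

lemma similarity_compose:
  "similarity r g \<Longrightarrow> similarity q h \<Longrightarrow> similarity (r * q) (g \<circ> h)"
  by (simp add: similarity_def)

lemma similarity_inv:
  assumes "similarity r g" "bij g"
  shows "similarity (inverse r) (inv g)"
proof -
  have "dist (inv g x) (inv g y) = inverse r * dist x y" for x y
  proof -
    have "dist x y = dist (g (inv g x)) (g (inv g y))"
      using assms(2) by (simp add: bij_is_surj surj_f_inv_f)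
    then have "dist x y = r * dist (inv g x) (inv g y)" "0 < r"
      using assms(1) by (simp_all add: similarity_def)
    then show ?thesis by (simp add: field_simps)
  qed
  then show ?thesis using assms(1) by (simp add: similarity_def)
qed

lemma similarity_continuous_on:
  assumes "similarity r g"
  shows "continuous_on S g"
proof (rule lipschitz_on_continuous_on)
  show "r-lipschitz_on S g"
    using assms by (intro lipschitz_onI) (simp_all add: similarity_def)
qed

text \<open>
  The preimage of the interior of \<open>g ` S\<close> is open by continuity and lies in \<open>S\<close> by injectivity.
\<close>

lemma similarity_interior_image_empty:
  assumes "similarity r g" "bij g" "interior S = {}"
  shows "interior (g ` S) = {}"
proof -
  have "open (g -` interior (g ` S))"
    using similarity_continuous_on[OF assms(1)] by (simp add: open_vimage)
  moreover have "g -` interior (g ` S) \<subseteq> S"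
    using interior_subset[of "g ` S"] bij_is_inj[OF assms(2)] by (auto dest: injD)
  ultimately have "g -` interior (g ` S) = {}"
    using assms(3) interior_maximal by blast
  then show ?thesis
    using bij_is_surj[OF assms(2)] by (metis empty_subsetI image_empty surj_image_vimage_eq)
qed

lemma similarity_interior_image_nonempty:
  assumes "similarity r g" "bij g" "interior S \<noteq> {}"
  shows "interior (g ` S) \<noteq> {}"
  using similarity_interior_image_empty[OF similarity_inv[OF assms(1,2)] bij_imp_bij_inv[OF assms(2)],
      of "g ` S"] assms(2,3)
  by (auto simp: image_inv_f_f bij_is_inj)


section \<open>Weights and maps of concatenated paths\<close>

lemma path_weight_simps [simp]:
  "path_weight d [] = 0"
  "path_weight d (e # \<sigma>) = d e + path_weight d \<sigma>"
  "path_weight d (\<sigma> @ \<tau>) = path_weight d \<sigma> + path_weight d \<tau>"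
  by (simp_all add: path_weight_def)

lemma path_weight_mono: "prefix \<tau> \<sigma> \<Longrightarrow> path_weight d \<tau> \<le> path_weight d \<sigma>"
  by (auto elim!: prefixE)

lemma length_le_path_weight:
  "(\<And>e. e \<in> set \<sigma> \<Longrightarrow> 0 < d e) \<Longrightarrow> length \<sigma> \<le> path_weight d \<sigma>"
proof (induction \<sigma>)
  case (Cons e \<sigma>)
  then have "length \<sigma> \<le> path_weight d \<sigma>" "0 < d e" by simp_all
  then show ?case by simp
qed simp

text \<open>
  The edge \<open>e\<close> is the one whose addition makes the weight exceed \<open>l\<close>; its weight bounds how far
  the weight of \<open>\<tau>\<close> can stay behind \<open>l\<close>.
\<close>

lemma split_at_weight:
  assumes "l < path_weight d \<sigma>"
  obtains \<tau> e \<rho> where "\<sigma> = \<tau> @ e # \<rho>" "path_weight d \<tau> \<le> l" "l < path_weight d \<tau> + d e"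
  using assms
proof (induction \<sigma> arbitrary: thesis rule: rev_induct)
  case (snoc e \<sigma>)
  show ?case
  proof (cases "l < path_weight d \<sigma>")
    case True
    then obtain \<tau> e' \<rho> where "\<sigma> = \<tau> @ e' # \<rho>" "path_weight d \<tau> \<le> l" "l < path_weight d \<tau> + d e'"
      using snoc.IH by blast
    then show ?thesis using snoc.prems(1)[of \<tau> e' "\<rho> @ [e]"] by simp
  next
    case False
    then show ?thesis using snoc.prems by simp
  qed
qed simp

lemma path_map_simps [simp]:
  "path_map f [] = id"
  "path_map f (e # \<sigma>) = f e \<circ> path_map f \<sigma>"
  by (simp_all add: path_map_def)

lemma path_map_append [simp]: "path_map f (\<sigma> @ \<tau>) = path_map f \<sigma> \<circ> path_map f \<tau>"
  by (induction \<sigma>) (simp_all add: comp_assoc)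

lemma path_map_similarity:
  assumes "\<And>e. e \<in> set \<sigma> \<Longrightarrow> similarity (s ^ d e) (f e) \<and> bij (f e)"
  shows "similarity (s ^ path_weight d \<sigma>) (path_map f \<sigma>) \<and> bij (path_map f \<sigma>)"
  using assms
proof (induction \<sigma>)
  case Nil
  show ?case by (simp add: similarity_def bij_def)
next
  case (Cons e \<sigma>)
  then have "similarity (s ^ path_weight d \<sigma>) (path_map f \<sigma>)" "bij (path_map f \<sigma>)"
    "similarity (s ^ d e) (f e)" "bij (f e)"
    by simp_all
  then show ?case
    unfolding path_map_simps path_weight_simps power_add by (intro conjI similarity_compose bij_comp)
qed

lemma initial_part_Suc [simp]: "initial_part \<theta> (Suc k) = initial_part \<theta> k @ [\<theta> k]"
  by (simp add: initial_part_def)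


section \<open>Subdivisions of the attractor into tiles of comparable size\<close>

locale attractor_gifs = fin_digraph G
  for G :: "('v, 'e) pre_digraph" +
  fixes f :: "'e \<Rightarrow> (real ^ 'n) \<Rightarrow> (real ^ 'n)"
    and A :: "'v \<Rightarrow> (real ^ 'n) set"
    and s :: real
    and d :: "'e \<Rightarrow> nat"
  assumes sim: "similarity_gifs G f s d"
    and attr: "attractor G f A"
    and nonoverlapping: "nonoverlapping_attractor G f A"
begin

lemma s_pos: "0 < s"
  using sim by (simp add: similarity_gifs_def)

lemma edge_facts:
  assumes "e \<in> arcs G"
  shows "0 < d e" "similarity (s ^ d e) (f e)" "bij (f e)" "contraction (f e)"
  using sim assms by (auto simp: similarity_gifs_def gifs_def)

lemma path_facts:
  assumes "set \<sigma> \<subseteq> arcs G"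
  shows "similarity (s ^ path_weight d \<sigma>) (path_map f \<sigma>)" "bij (path_map f \<sigma>)"
  using path_map_similarity[of \<sigma> s d f] assms edge_facts(2,3) by auto

lemma inverse_path_facts:
  assumes "set \<sigma> \<subseteq> arcs G"
  shows "similarity (inverse s ^ path_weight d \<sigma>) (path_map (\<lambda>e. inv (f e)) \<sigma>)"
    "bij (path_map (\<lambda>e. inv (f e)) \<sigma>)"
proof -
  have "similarity (inverse s ^ d e) (inv (f e)) \<and> bij (inv (f e))" if "e \<in> set \<sigma>" for e
    using similarity_inv[of "s ^ d e" "f e"] edge_facts(2,3)[of e] assms that
    by (auto simp: power_inverse bij_imp_bij_inv)
  then show "similarity (inverse s ^ path_weight d \<sigma>) (path_map (\<lambda>e. inv (f e)) \<sigma>)"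
    "bij (path_map (\<lambda>e. inv (f e)) \<sigma>)"
    using path_map_similarity[of \<sigma> "inverse s" d "\<lambda>e. inv (f e)"] by auto
qed

lemma component_compact: "v \<in> verts G \<Longrightarrow> compact (A v)"
  using attr unfolding attractor_def by blast

text \<open>
  A component is a union over the outgoing edges, so it would be empty if there were none.
\<close>

lemma out_edge:
  assumes "v \<in> verts G"
  obtains e where "e \<in> arcs G" "tail G e = v"
  using attr assms unfolding attractor_def by fastforce

text \<open>
  Some edge exists, and its map is at once a contraction and a similarity of ratio a power of \<open>s\<close>;
  comparing the two on a pair of distinct points bounds \<open>s\<close>.
\<close>

lemma s_less_1:
  assumes "v \<in> verts G"
  shows "s < 1"
proof -
  obtain e where e: "e \<in> arcs G" using out_edge[OF assms] by blast
  then obtain c where c: "c < 1" "c-lipschitz_on UNIV (f e)"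
    using edge_facts(4) by (auto simp: contraction_def)
  have "dist (f e 0) (f e (axis undefined 1)) \<le> c * dist 0 (axis undefined 1 :: real ^ 'n)"
    using c(2) by (rule lipschitz_onD) simp_all
  then have "s ^ d e \<le> c"
    using edge_facts(2)[OF e] by (simp add: similarity_def dist_norm)
  with c(1) have "s ^ d e < 1" by simp
  then show ?thesis using s_pos
    by (metis linorder_not_le one_le_power)
qed

lemma edge_image_subset:
  assumes "e \<in> arcs G"
  shows "f e ` A (head G e) \<subseteq> A (tail G e)"
  using attr assms wellformed(1)[of e] unfolding attractor_def by fastforce

lemma path_image_subset:
  "awalk v \<sigma> w \<Longrightarrow> path_map f \<sigma> ` A w \<subseteq> A v"
proof (induction \<sigma> arbitrary: v)
  case Nil
  then show ?case by (simp add: awalk_Nil_iff)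
next
  case (Cons e \<sigma>)
  then have e: "e \<in> arcs G" "v = tail G e" "awalk (head G e) \<sigma> w"
    by (simp_all add: awalk_Cons_iff)
  have "path_map f (e # \<sigma>) ` A w = f e ` path_map f \<sigma> ` A w" by (simp add: image_comp)
  also have "\<dots> \<subseteq> f e ` A (head G e)" using Cons.IH[OF e(3)] by blast
  also have "\<dots> \<subseteq> A v" using edge_image_subset[OF e(1)] e(2) by simp
  finally show ?case .
qed

text \<open>
  A cut consists of the paths from \<open>v\<close> stopped at the first edge by which their weight exceeds \<open>m\<close>.
  The balanced sequence consists of such cuts; freeing \<open>v\<close> and \<open>m\<close> from the parameter allows a cut
  to be continued from the end of any path.
\<close>

definition weight_cut :: "'v \<Rightarrow> nat \<Rightarrow> 'e list set" where
  "weight_cut v m = {\<sigma>. awalk v \<sigma> (awlast v \<sigma>) \<and> \<sigma> \<noteq> [] \<and>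
     path_weight d (butlast \<sigma>) \<le> m \<and> m < path_weight d \<sigma>}"

text \<open>
  The self-similarity of cuts, from which all inclusions between subdivisions are derived. The bound
  on the weight of \<open>\<tau>\<close> excludes the case that \<open>\<tau>\<close> itself, with \<open>\<rho>\<close> empty, lies in the cut.
\<close>

lemma weight_cut_append_iff:
  assumes "awalk v \<tau> w" "path_weight d \<tau> \<le> m"
  shows "\<tau> @ \<rho> \<in> weight_cut v m \<longleftrightarrow> \<rho> \<in> weight_cut w (m - path_weight d \<tau>)"
proof (cases "\<rho> = []")
  case True
  then show ?thesis using assms by (simp add: weight_cut_def)
next
  case False
  have "awlast v \<tau> = w" using assms(1) by auto
  then show ?thesis using assms False
    by (auto simp: weight_cut_def butlast_append awlast_append)
qed

lemma strict_prefix_weight_le: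
  assumes "\<sigma> \<in> weight_cut v m" "strict_prefix \<tau> \<sigma>"
  shows "path_weight d \<tau> \<le> m"
proof -
  have "prefix \<tau> (butlast \<sigma>)"
    using assms(2) by (metis prefix_order.less_le prefix_snoc append_butlast_last_id
        prefix_bot.not_eq_extremum strict_prefix_simps(1) prefix_bot.bot_least)
  then show ?thesis using path_weight_mono[of \<tau> "butlast \<sigma>" d] assms(1) by (simp add: weight_cut_def)
qed

lemma weight_cut_antichain:
  assumes "\<sigma> \<in> weight_cut v m" "\<sigma>' \<in> weight_cut v m" "\<sigma> \<noteq> \<sigma>'"
  shows "\<sigma> \<parallel> \<sigma>'"
  using assms strict_prefix_weight_le[of \<sigma> v m \<sigma>'] strict_prefix_weight_le[of \<sigma>' v m \<sigma>]
  by (auto simp: weight_cut_def strict_prefix_def parallel_def)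

text \<open>
  Edges have positive weight, so all but the last of the edges number at most \<open>m\<close>.
\<close>

lemma finite_weight_cut: "finite (weight_cut v m)"
proof (rule finite_subset)
  show "weight_cut v m \<subseteq> {\<sigma>. set \<sigma> \<subseteq> arcs G \<and> length \<sigma> \<le> Suc m}"
  proof
    fix \<sigma> assume \<sigma>: "\<sigma> \<in> weight_cut v m"
    then have arcs: "set \<sigma> \<subseteq> arcs G" by (auto simp: weight_cut_def)
    then have "length (butlast \<sigma>) \<le> path_weight d (butlast \<sigma>)"
      by (intro length_le_path_weight edge_facts(1)) (auto dest: in_set_butlastD)
    then show "\<sigma> \<in> {\<sigma>. set \<sigma> \<subseteq> arcs G \<and> length \<sigma> \<le> Suc m}"
      using \<sigma> arcs by (auto simp: weight_cut_def)
  qed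
  show "finite {\<sigma>. set \<sigma> \<subseteq> arcs G \<and> length \<sigma> \<le> Suc m}"
    by (rule finite_lists_length_le) simp
qed

text \<open>
  Every vertex has an outgoing edge, so the path can be continued; as each edge adds to the weight,
  the weight eventually exceeds \<open>m\<close>.
\<close>

lemma weight_cut_extends:
  assumes "awalk v \<tau> (tail G e)" "path_weight d \<tau> \<le> m" "e \<in> arcs G"
  shows "\<exists>\<rho>\<in>weight_cut v m. prefix (\<tau> @ [e]) \<rho>"
  using assms
proof (induction "m - path_weight d \<tau>" arbitrary: \<tau> e rule: less_induct)
  case less
  have walk: "awalk v (\<tau> @ [e]) (head G e)"
    using awalk_appendI[OF less.prems(1) arc_implies_awalk[OF less.prems(3)]] .
  show ?case
  proof (cases "path_weight d (\<tau> @ [e]) \<le> m")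
    case True
    obtain e' where e': "e' \<in> arcs G" "tail G e' = head G e"
      using out_edge[of "head G e"] less.prems(3) by auto
    have "\<exists>\<rho>\<in>weight_cut v m. prefix ((\<tau> @ [e]) @ [e']) \<rho>"
      using True walk e' edge_facts(1)[OF less.prems(3)] by (intro less.hyps) auto
    then show ?thesis using append_prefixD by blast
  next
    case False
    have "awlast v (\<tau> @ [e]) = head G e" using walk by (rule awlast_of_awalk) (simp add: NOMATCH_def)
    with walk False less.prems(2) have "\<tau> @ [e] \<in> weight_cut v m"
      by (simp add: weight_cut_def del: awalk_append_iff)
    then show ?thesis by blast
  qed
qed

lemma pre_tree_weight_cut:
  assumes "v \<in> verts G"
  shows "pre_tree G v (weight_cut v m)"
  unfolding pre_tree_def
proof (intro conjI ballI allI impI)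
  show "finite (weight_cut v m)" by (rule finite_weight_cut)
  obtain e where "e \<in> arcs G" "tail G e = v" using out_edge[OF assms] .
  then show "weight_cut v m \<noteq> {}"
    using weight_cut_extends[of v "[]" e m] assms by (auto simp: awalk_Nil_iff)
  show "weight_cut v m \<subseteq> paths_from G v" by (auto simp: weight_cut_def paths_from_def)
  fix \<sigma> \<tau> assume \<sigma>: "\<sigma> \<in> weight_cut v m"
  show "\<tau> \<notin> weight_cut v m" if "strict_prefix \<tau> \<sigma>"
    using strict_prefix_weight_le[OF \<sigma> that] by (simp add: weight_cut_def)
  fix e assume *: "strict_prefix \<tau> \<sigma> \<and> e \<in> out_arcs G (awlast v \<tau>)"
  then obtain \<rho> where "\<sigma> = \<tau> @ \<rho>" by (auto elim: strict_prefixE prefixE)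
  then have "awalk v \<tau> (tail G e)" using \<sigma> * by (simp add: weight_cut_def)
  then show "\<exists>\<rho>\<in>weight_cut v m. prefix (\<tau> @ [e]) \<rho>"
    using weight_cut_extends strict_prefix_weight_le[OF \<sigma>] * by auto
qed

definition subdivision :: "'v \<Rightarrow> nat \<Rightarrow> (real ^ 'n) set set" where
  "subdivision v m = (\<lambda>\<sigma>. path_map f \<sigma> ` A (awlast v \<sigma>)) ` weight_cut v m"

lemma subdivision_subset:
  assumes "t \<in> subdivision v m"
  shows "t \<subseteq> A v"
proof -
  obtain \<sigma> where "awalk v \<sigma> (awlast v \<sigma>)" "t = path_map f \<sigma> ` A (awlast v \<sigma>)"
    using assms by (auto simp: subdivision_def weight_cut_def)
  then show ?thesis using path_image_subset by simp
qed

lemma subdivision_refines: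
  assumes "awalk v \<tau> w" "path_weight d \<tau> \<le> m" "t \<in> subdivision w (m - path_weight d \<tau>)"
  shows "path_map f \<tau> ` t \<in> subdivision v m"
proof -
  obtain \<rho> where \<rho>: "\<rho> \<in> weight_cut w (m - path_weight d \<tau>)" "t = path_map f \<rho> ` A (awlast w \<rho>)"
    using assms(3) by (auto simp: subdivision_def)
  have "awlast v \<tau> = w" using assms(1) by auto
  then have "path_map f \<tau> ` t = path_map f (\<tau> @ \<rho>) ` A (awlast v (\<tau> @ \<rho>))"
    by (simp add: \<rho>(2) image_comp awlast_append)
  moreover have "\<tau> @ \<rho> \<in> weight_cut v m" using weight_cut_append_iff[OF assms(1,2)] \<rho>(1) by simp
  ultimately show ?thesis unfolding subdivision_def by (rule image_eqI)
qed

lemma subdivision_tile: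
  assumes "t \<in> subdivision v m"
  shows "tile t"
proof -
  obtain \<sigma> where \<sigma>: "\<sigma> \<in> weight_cut v m" and t: "t = path_map f \<sigma> ` A (awlast v \<sigma>)"
    using assms by (auto simp: subdivision_def)
  then have arcs: "set \<sigma> \<subseteq> arcs G" and "awlast v \<sigma> \<in> verts G"
    by (auto simp: weight_cut_def)
  then have "compact (A (awlast v \<sigma>))" "interior (A (awlast v \<sigma>)) \<noteq> {}"
    using component_compact nonoverlapping by (simp_all add: nonoverlapping_attractor_def)
  then show ?thesis
    using path_facts[OF arcs] unfolding tile_def t
    by (auto intro!: compact_continuous_image similarity_continuous_on
        dest: similarity_interior_image_nonempty)
qed

text \<open>
  At the vertex where the two paths part they take distinct edges \<open>e\<close> and \<open>e'\<close>, and the two sets lie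
  in the images under the map of the common initial segment of the non-overlapping sets for \<open>e\<close>
  and \<open>e'\<close>.
\<close>

lemma parallel_paths_nonoverlapping:
  assumes "awalk v \<sigma> w" "awalk v \<sigma>' w'" "\<sigma> \<parallel> \<sigma>'"
  shows "interior (path_map f \<sigma> ` A w \<inter> path_map f \<sigma>' ` A w') = {}"
proof -
  obtain \<tau> e \<rho> e' \<rho>' where eq: "e \<noteq> e'" "\<sigma> = \<tau> @ e # \<rho>" "\<sigma>' = \<tau> @ e' # \<rho>'"
    using parallel_decomp[OF assms(3)] by blast
  define u where "u = awlast v \<tau>"
  have walks: "awalk v \<tau> u" "e \<in> arcs G" "tail G e = u" "awalk (head G e) \<rho> w"
    "e' \<in> arcs G" "tail G e' = u" "awalk (head G e') \<rho>' w'"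
    using assms(1,2) by (auto simp: eq awalk_Cons_iff u_def)
  have "u \<in> verts G" using walks(1) by auto
  then have "interior (f e ` A (head G e) \<inter> f e' ` A (head G e')) = {}"
    using nonoverlapping walks eq(1) by (simp add: nonoverlapping_attractor_def)
  moreover have \<tau>: "similarity (s ^ path_weight d \<tau>) (path_map f \<tau>)" "bij (path_map f \<tau>)"
    using walks(1) path_facts[of \<tau>] by auto
  ultimately have "interior (path_map f \<tau> ` (f e ` A (head G e) \<inter> f e' ` A (head G e'))) = {}"
    by (intro similarity_interior_image_empty)
  moreover have "path_map f \<sigma> ` A w = path_map f \<tau> ` f e ` path_map f \<rho> ` A w"
    "path_map f \<sigma>' ` A w' = path_map f \<tau> ` f e' ` path_map f \<rho>' ` A w'"
    by (simp_all add: eq image_comp comp_assoc)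
  then have "path_map f \<sigma> ` A w \<inter> path_map f \<sigma>' ` A w' \<subseteq>
      path_map f \<tau> ` (f e ` A (head G e) \<inter> f e' ` A (head G e'))"
    using path_image_subset[OF walks(4)] path_image_subset[OF walks(7)]
    unfolding image_Int[OF bij_is_inj[OF \<tau>(2)]] by blast
  ultimately show ?thesis using interior_mono by blast
qed

lemma subdivision_nonoverlapping:
  assumes "t \<in> subdivision v m" "t' \<in> subdivision v m" "t \<noteq> t'"
  shows "interior (t \<inter> t') = {}"
proof -
  obtain \<sigma> \<sigma>' where "\<sigma> \<in> weight_cut v m" "\<sigma>' \<in> weight_cut v m"
    and t: "t = path_map f \<sigma> ` A (awlast v \<sigma>)" "t' = path_map f \<sigma>' ` A (awlast v \<sigma>')"
    using assms(1,2) by (auto simp: subdivision_def)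
  moreover from this have "\<sigma> \<parallel> \<sigma>'" using weight_cut_antichain assms(3) by blast
  ultimately show ?thesis
    unfolding t by (intro parallel_paths_nonoverlapping) (auto simp: weight_cut_def)
qed

end


section \<open>Balanced tilings\<close>

locale parametrized_gifs = attractor_gifs G f A s d
  for G :: "('v, 'e) pre_digraph"
    and f :: "'e \<Rightarrow> (real ^ 'n) \<Rightarrow> (real ^ 'n)"
    and A :: "'v \<Rightarrow> (real ^ 'n) set"
    and s :: real
    and d :: "'e \<Rightarrow> nat" +
  fixes \<theta> :: "nat \<Rightarrow> 'e"
  assumes param: "parameter G \<theta>"
begin

abbreviation vertex :: "nat \<Rightarrow> 'v" where
  "vertex k \<equiv> param_vertex G \<theta> k"

definition weight :: "nat \<Rightarrow> nat" where
  "weight k = path_weight d (initial_part \<theta> k)"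

definition expansion :: "nat \<Rightarrow> (real ^ 'n) \<Rightarrow> (real ^ 'n)" where
  "expansion k = path_map (\<lambda>e. inv (f e)) (initial_part \<theta> k)"

abbreviation level :: "nat \<Rightarrow> (real ^ 'n) set set" where
  "level k \<equiv> level_tiling G f A \<theta> (balanced_sequence G d \<theta>) k"

lemma parameter_edge:
  "\<theta> k \<in> arcs G" "head G (\<theta> k) = vertex k" "tail G (\<theta> k) = vertex (Suc k)"
  using param
  by (auto simp: parameter_def infinite_path_def reverse_graph_def param_vertex_def)

lemma parameter_walk: "awalk (vertex (Suc k)) [\<theta> k] (vertex k)"
  using arc_implies_awalk[OF parameter_edge(1)[of k]] parameter_edge[of k] by simp

lemma vertex_in_verts: "vertex k \<in> verts G"
  using parameter_edge[of k] head_in_verts by metis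

lemma weight_Suc: "weight (Suc k) = weight k + d (\<theta> k)"
  by (simp add: weight_def)

lemma le_weight: "k \<le> weight k"
proof (induction k)
  case (Suc k)
  then show ?case using edge_facts(1)[OF parameter_edge(1), of k] by (simp add: weight_Suc)
qed simp

lemma expansion_facts:
  "similarity (inverse s ^ weight k) (expansion k)" "bij (expansion k)"
  using inverse_path_facts[of "initial_part \<theta> k"] parameter_edge(1)
  by (auto simp: weight_def expansion_def initial_part_def)

text \<open>
  The last factor of the expansion at \<open>k + 1\<close> undoes the map of the edge \<open>\<theta> k\<close>. This is what puts
  the tiles of level \<open>k\<close> among those of level \<open>k + 1\<close>.
\<close>

lemma expansion_Suc: "expansion (Suc k) (f (\<theta> k) x) = expansion k x"
  using edge_facts(3)[OF parameter_edge(1), of k]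
  by (simp add: expansion_def bij_is_inj)

text \<open>
  The edges of the parameter, traversed in the direction that they have in \<open>G\<close>, lead from later
  vertices to earlier ones.
\<close>

lemma backward_path:
  assumes "k \<le> K"
  obtains \<pi> where "awalk (vertex K) \<pi> (vertex k)" "weight K = path_weight d \<pi> + weight k"
  using assms
proof (induction K arbitrary: thesis rule: dec_induct)
  case base
  show ?case using base(1)[of "[]"] vertex_in_verts by (simp add: awalk_Nil_iff)
next
  case (step K)
  obtain \<pi> where "awalk (vertex K) \<pi> (vertex k)" "weight K = path_weight d \<pi> + weight k"
    using step.IH by blast
  then show ?case
    using step.prems[of "\<theta> K # \<pi>"] parameter_edge[of K] by (simp add: awalk_Cons_iff weight_Suc)
qed

lemma balanced_sequence_eq_weight_cut: "balanced_sequence G d \<theta> k = weight_cut (vertex k) (weight k)"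
proof -
  have "path_weight d (butlast \<sigma>) + d (last \<sigma>) = path_weight d \<sigma>" if "\<sigma> \<noteq> []" for \<sigma>
    using that path_weight_simps(3)[of d "butlast \<sigma>" "[last \<sigma>]"] by simp
  moreover have "(\<exists>w. awalk v \<sigma> w) \<longleftrightarrow> awalk v \<sigma> (awlast v \<sigma>)" for v \<sigma>
    by (auto dest: awlast_of_awalk)
  ultimately show ?thesis
    unfolding balanced_sequence_def weight_cut_def weight_def paths_from_def
    by (intro Collect_cong) (smt (verit) of_nat_add of_nat_le_iff of_nat_less_iff mem_Collect_eq)
qed

text \<open>
  Each level is the similar image of a subdivision that depends only on a vertex and a weight;
  this allows a level to be found again elsewhere.
\<close>

lemma level_eq: "level k = (`) (expansion k) ` subdivision (vertex k) (weight k)"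
  by (simp add: level_tiling_def balanced_sequence_eq_weight_cut subdivision_def expansion_def image_image
      image_comp)

lemma theta_sequence_balanced: "theta_sequence G \<theta> (balanced_sequence G d \<theta>)"
  unfolding theta_sequence_def balanced_sequence_eq_weight_cut
proof (intro conjI allI)
  fix k
  show "pre_tree G (vertex k) (weight_cut (vertex k) (weight k))"
    by (rule pre_tree_weight_cut[OF vertex_in_verts])
  show "(#) (\<theta> k) ` weight_cut (vertex k) (weight k) \<subseteq> weight_cut (vertex (Suc k)) (weight (Suc k))"
    using weight_cut_append_iff[OF parameter_walk, of k "weight (Suc k)"]
    by (auto simp: weight_Suc)
qed

lemma level_mono:
  assumes "k \<le> K"
  shows "level k \<subseteq> level K"
proof -
  have "level k \<subseteq> level (Suc k)" for k
  proof
    fix t assume "t \<in> level k"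
    then obtain t' where t': "t' \<in> subdivision (vertex k) (weight k)" "t = expansion k ` t'"
      by (auto simp: level_eq)
    have "f (\<theta> k) ` t' \<in> subdivision (vertex (Suc k)) (weight (Suc k))"
      using subdivision_refines[OF parameter_walk, of k "weight (Suc k)" t'] t'(1)
      by (simp add: weight_Suc)
    moreover have "t = expansion (Suc k) ` f (\<theta> k) ` t'"
      by (simp add: t'(2) image_image expansion_Suc)
    ultimately show "t \<in> level (Suc k)" by (simp add: level_eq)
  qed
  then show ?thesis using assms by (rule lift_Suc_mono_le)
qed

lemma balanced_tiling_eq: "balanced_tiling G f A d \<theta> = (\<Union>k. level k)"
  by (simp add: balanced_tiling_def gifs_tiling_def)

text \<open>The levels form an increasing chain.\<close>

lemma finite_patch_in_level:
  assumes "finite P" "P \<subseteq> balanced_tiling G f A d \<theta>"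
  obtains k where "P \<subseteq> level k"
proof -
  have "\<exists>k. P \<subseteq> level k"
    using assms
  proof (induction P rule: finite_induct)
    case (insert t P)
    then obtain k k' where "P \<subseteq> level k" "t \<in> level k'" by (auto simp: balanced_tiling_eq)
    then have "insert t P \<subseteq> level (max k k')"
      using level_mono[of k "max k k'"] level_mono[of k' "max k k'"] by auto
    then show ?case by blast
  qed simp
  then show ?thesis using that by blast
qed

lemma tiling_balanced:
  assumes "filling G f A \<theta>"
  shows "tiling UNIV (balanced_tiling G f A d \<theta>)"
  unfolding tiling_def
proof (intro conjI ballI impI)
  show "\<Union> (balanced_tiling G f A d \<theta>) = UNIV"
    using assms theta_sequence_balanced unfolding filling_def balanced_tiling_def by blast
  fix t assume t: "t \<in> balanced_tiling G f A d \<theta>"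
  then obtain k r where "r \<in> subdivision (vertex k) (weight k)" "t = expansion k ` r"
    by (auto simp: balanced_tiling_eq level_eq)
  then show "tile t"
    using subdivision_tile[of r] expansion_facts[of k]
    by (auto simp: tile_def intro!: compact_continuous_image similarity_continuous_on
        dest: similarity_interior_image_nonempty)
  fix t' assume t': "t' \<in> balanced_tiling G f A d \<theta>" and ne: "t \<noteq> t'"
  obtain k where "t \<in> level k" "t' \<in> level k"
    using finite_patch_in_level[of "{t, t'}"] t t' by auto
  then obtain r r' where r: "r \<in> subdivision (vertex k) (weight k)" "t = expansion k ` r"
      "r' \<in> subdivision (vertex k) (weight k)" "t' = expansion k ` r'"
    by (auto simp: level_eq)
  then have "interior (r \<inter> r') = {}" using subdivision_nonoverlapping ne by blast
  then have "interior (expansion k ` (r \<inter> r')) = {}"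
    using expansion_facts similarity_interior_image_empty by blast
  then show "interior (t \<inter> t') = {}"
    by (simp add: r image_Int[OF bij_is_inj[OF expansion_facts(2)]])
qed

text \<open>
  The core of repetitivity. By the weight condition, going down from \<open>vertex K\<close> along \<open>\<tau>\<close> and \<open>\<rho>\<close>
  uses up exactly the difference between the weights of the two levels. Therefore the subdivision
  of the component at \<open>vertex k\<close> that is met there inside level \<open>K\<close> is the one that level \<open>k\<close> is
  made of, and it is seen at the same scale.
\<close>

lemma repeated_level:
  assumes \<tau>: "awalk (vertex K) \<tau> w" and \<rho>: "awalk w \<rho> (vertex k)"
    and weights: "weight K = weight k + path_weight d \<tau> + path_weight d \<rho>"
    and P: "P \<subseteq> level k"
  shows "\<exists>Q\<subseteq>level K. isometric_patches P Q \<and> \<Union>Q \<subseteq> (expansion K \<circ> path_map f \<tau>) ` A w"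
proof -
  \<comment> \<open>The map \<open>\<phi>\<close> returns level \<open>k\<close> to the subdivision that it comes from and sends that
    subdivision into level \<open>K\<close>; the scaling ratios cancel.\<close>
  define h where "h = expansion K \<circ> path_map f \<tau> \<circ> path_map f \<rho>"
  define \<phi> where "\<phi> = h \<circ> inv (expansion k)"
  have arcs: "set \<tau> \<subseteq> arcs G" "set \<rho> \<subseteq> arcs G"
    using \<tau> \<rho> by (simp_all add: awalk_def)
  have "similarity (inverse s ^ weight K * s ^ path_weight d \<tau> * s ^ path_weight d \<rho>
      * inverse (inverse s ^ weight k)) \<phi>"
    unfolding \<phi>_def h_def
    by (intro similarity_compose similarity_inv expansion_facts path_facts arcs)
  moreover have "inverse s ^ weight K * s ^ path_weight d \<tau> * s ^ path_weight d \<rho>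
      * inverse (inverse s ^ weight k) = 1"
    using s_pos by (simp add: weights power_add power_inverse field_simps)
  ultimately have iso: "dist (\<phi> x) (\<phi> y) = dist x y" for x y by (simp add: similarity_def)
  have bij: "bij \<phi>"
    unfolding \<phi>_def h_def
    by (intro bij_comp bij_imp_bij_inv expansion_facts path_facts arcs)
  have image: "\<phi> ` t \<in> level K \<and> \<phi> ` t \<subseteq> (expansion K \<circ> path_map f \<tau>) ` A w" if t: "t \<in> P" for t
  proof -
    obtain r where r: "r \<in> subdivision (vertex k) (weight k)" "t = expansion k ` r"
      using t P by (auto simp: level_eq)
    have "\<phi> ` t = h ` r"
      by (simp add: r(2) \<phi>_def image_image bij_is_inj[OF expansion_facts(2)])
    then have \<phi>_t: "\<phi> ` t = expansion K ` path_map f \<tau> ` path_map f \<rho> ` r"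
      by (simp add: h_def image_comp)
    have sub: "path_map f \<rho> ` r \<in> subdivision w (weight K - path_weight d \<tau>)"
      using subdivision_refines[OF \<rho>, of "weight K - path_weight d \<tau>" r] r(1)
      by (simp add: weights)
    then have "path_map f \<tau> ` path_map f \<rho> ` r \<in> subdivision (vertex K) (weight K)"
      using subdivision_refines[OF \<tau>, of "weight K"] by (simp add: weights)
    moreover have "path_map f \<rho> ` r \<subseteq> A w" by (rule subdivision_subset[OF sub])
    ultimately show ?thesis
      unfolding \<phi>_t level_eq image_comp[symmetric] by (intro conjI imageI image_mono)
  qed
  have "isometric_patches P ((`) \<phi> ` P)"
    using bij iso by (auto simp: isometric_patches_def)
  moreover have "(`) \<phi> ` P \<subseteq> level K" using image by blast
  moreover have "\<Union>((`) \<phi> ` P) \<subseteq> (expansion K \<circ> path_map f \<tau>) ` A w" using image by blast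
  ultimately show ?thesis by blast
qed

text \<open>
  One bound serves all vertices, of which there are finitely many.
\<close>

lemma components_bounded: "\<exists>\<Delta>>0. \<forall>v\<in>verts G. \<forall>x\<in>A v. \<forall>y\<in>A v. dist x y < \<Delta>"
proof -
  have "bounded (\<Union>v\<in>verts G. A v)"
    by (simp add: bounded_UN compact_imp_bounded component_compact)
  then obtain a b where ab: "\<And>x. x \<in> (\<Union>v\<in>verts G. A v) \<Longrightarrow> dist a x \<le> b"
    unfolding bounded_def by blast
  have "dist x y < 2 * \<bar>b\<bar> + 1" if "v \<in> verts G" "x \<in> A v" "y \<in> A v" for v x y
    using ab[of x] ab[of y] that dist_triangle3[of x y a] by fastforce
  then show ?thesis by (intro exI[of _ "2 * \<bar>b\<bar> + 1"]) simp
qed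

text \<open>
  Given a point, \<open>repeated_level\<close> is applied with a path \<open>\<tau>\<close> whose piece \<open>g ` A w\<close> contains the point.
  The path \<open>\<tau>\<close> has to be short enough for the triangle property to provide \<open>\<rho>\<close>, and long enough to
  bound the diameter of that piece; the weights that remain after \<open>\<tau>\<close> range over the interval from
  \<open>M\<close> to \<open>M + B\<close>.
\<close>

lemma repetitive_balanced:
  assumes fill: "filling G f A \<theta>" and tri: "triangle_property G d"
  shows "repetitive (balanced_tiling G f A d \<theta>)"
  unfolding repetitive_def
proof (intro conjI allI impI tiling_balanced fill)
  fix P assume "finite P \<and> P \<subseteq> balanced_tiling G f A d \<theta>"
  then obtain k where k: "P \<subseteq> level k" using finite_patch_in_level by blast
  obtain N :: int where N: "\<And>u v w p q. awalk u p v \<Longrightarrow> awalk u q w \<Longrightarrow>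
      N \<le> int (path_weight d p) - int (path_weight d q) \<Longrightarrow>
      \<exists>r. awalk w r v \<and> path_weight d p = path_weight d q + path_weight d r"
    using tri unfolding triangle_property_def by (metis awalk_hd_in_verts awalk_last_in_verts)
  obtain \<Delta> where \<Delta>: "0 < \<Delta>"
    "\<And>v x y. v \<in> verts G \<Longrightarrow> x \<in> A v \<Longrightarrow> y \<in> A v \<Longrightarrow> dist x y < \<Delta>"
    using components_bounded by blast
  \<comment> \<open>With at least \<open>M\<close> of the weight remaining after \<open>\<tau>\<close>, the weight left once \<open>weight k\<close> is
    reserved for the copy of level \<open>k\<close> is at least \<open>N\<close>, as the triangle property demands.\<close>
  define M where "M = nat N + weight k"
  define B where "B = Max (d ` arcs G)"
  define R where "R = inverse s ^ (M + B) * \<Delta>"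
  have s: "0 < s" "s < 1" using s_pos s_less_1[OF vertex_in_verts] by simp_all
  show "\<exists>R>0. \<forall>x. \<exists>Q\<subseteq>balanced_tiling G f A d \<theta>. isometric_patches P Q \<and> \<Union> Q \<subseteq> ball x R"
  proof (intro exI[of _ R] conjI allI)
    show "0 < R" using \<Delta>(1) s by (simp add: R_def)
    fix x
    have "x \<in> \<Union> (balanced_tiling G f A d \<theta>)"
      using tiling_balanced[OF fill] by (simp add: tiling_def)
    then obtain j t where "t \<in> level j" "x \<in> t" by (auto simp: balanced_tiling_eq)
    \<comment> \<open>The first \<open>K\<close> edges weigh at least \<open>K\<close>, so \<open>K \<ge> M\<close> leaves room to cut \<open>M\<close> units off.\<close>
    moreover define K where "K = max j (max M k)"
    ultimately have "t \<in> level K" using level_mono[of j K] by auto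
    then obtain \<sigma> where \<sigma>: "\<sigma> \<in> weight_cut (vertex K) (weight K)"
      and t: "t = expansion K ` path_map f \<sigma> ` A (awlast (vertex K) \<sigma>)"
      by (auto simp: level_eq subdivision_def)
    have MK: "M \<le> weight K" "k \<le> K" using le_weight[of K] by (simp_all add: K_def)
    have "weight K < path_weight d \<sigma>" using \<sigma> by (simp add: weight_cut_def)
    then have "weight K - M < path_weight d \<sigma>" by linarith
    then obtain \<tau> e \<rho> where split: "\<sigma> = \<tau> @ e # \<rho>" "path_weight d \<tau> \<le> weight K - M"
      "weight K - M < path_weight d \<tau> + d e"
      by (rule split_at_weight)
    define w where "w = awlast (vertex K) \<tau>"
    have \<tau>: "awalk (vertex K) \<tau> w" and rest: "awalk w (e # \<rho>) (awlast (vertex K) \<sigma>)"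
      using \<sigma> by (simp_all add: weight_cut_def split w_def)
    have e: "e \<in> arcs G" using rest by (simp add: awalk_Cons_iff)
    then have "d e \<le> B" by (simp add: B_def)
    define m where "m = weight K - path_weight d \<tau>"
    have m: "M \<le> m" "m \<le> M + B" "weight K = path_weight d \<tau> + m"
      using split(2,3) MK(1) \<open>d e \<le> B\<close> by (simp_all add: m_def)
    obtain \<pi> where \<pi>: "awalk (vertex K) \<pi> (vertex k)" "weight K = path_weight d \<pi> + weight k"
      using backward_path[OF MK(2)] .
    have "N \<le> int (path_weight d \<pi>) - int (path_weight d \<tau>)"
      using m(1,3) \<pi>(2) by (simp add: M_def)
    then obtain r where r: "awalk w r (vertex k)"
      "path_weight d \<pi> = path_weight d \<tau> + path_weight d r"
      using N[OF \<pi>(1) \<tau>] by blast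
    define g where "g = expansion K \<circ> path_map f \<tau>"
    obtain Q where Q: "Q \<subseteq> level K" "isometric_patches P Q" "\<Union>Q \<subseteq> g ` A w"
      using repeated_level[OF \<tau> r(1) _ k] \<pi>(2) r(2) by (auto simp: g_def)
    have "similarity (inverse s ^ weight K * s ^ path_weight d \<tau>) g"
      unfolding g_def using \<tau>
      by (intro similarity_compose expansion_facts path_facts) (simp add: awalk_def)
    moreover have "inverse s ^ weight K * s ^ path_weight d \<tau> = inverse s ^ m"
      using s by (simp add: m(3) power_add power_inverse field_simps)
    ultimately have g: "dist (g y) (g z) = inverse s ^ m * dist y z" for y z
      by (simp add: similarity_def)
    \<comment> \<open>The tile of \<open>x\<close> belongs to a path that continues \<open>\<tau>\<close>, hence lies in the piece of \<open>\<tau>\<close>.\<close>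
    have "t = g ` path_map f (e # \<rho>) ` A (awlast (vertex K) \<sigma>)"
      by (simp add: t g_def split image_comp comp_assoc)
    then have "x \<in> g ` A w"
      using path_image_subset[OF rest] \<open>x \<in> t\<close> by blast
    then obtain a where a: "a \<in> A w" "x = g a" by blast
    have "g ` A w \<subseteq> ball x R"
    proof
      fix y assume "y \<in> g ` A w"
      then obtain b where b: "b \<in> A w" "y = g b" by blast
      have "w \<in> verts G" by (rule awalk_last_in_verts[OF \<tau>])
      then have "dist a b < \<Delta>" using \<Delta>(2) a(1) b(1) by blast
      then have "dist x y < inverse s ^ m * \<Delta>" using s by (simp add: a(2) b(2) g)
      also have "\<dots> \<le> R"
        unfolding R_def using s m(2) \<Delta>(1)
        by (intro mult_right_mono power_increasing) (simp_all add: field_simps)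
      finally show "y \<in> ball x R" by simp
    qed
    then have "\<Union>Q \<subseteq> ball x R" using Q(3) by blast
    moreover have "Q \<subseteq> balanced_tiling G f A d \<theta>" using Q(1) by (auto simp: balanced_tiling_eq)
    ultimately show "\<exists>Q\<subseteq>balanced_tiling G f A d \<theta>. isometric_patches P Q \<and> \<Union> Q \<subseteq> ball x R"
      using Q(2) by blast
  qed
qed

end

theorem theorem6:
  fixes G :: "('v, 'e) pre_digraph"
    and f :: "'e \<Rightarrow> (real ^ 'n) \<Rightarrow> (real ^ 'n)"
    and A :: "'v \<Rightarrow> (real ^ 'n) set"
    and s :: real
    and d :: "'e \<Rightarrow> nat"
  assumes "similarity_gifs G f s d"
    and "attractor G f A"
    and "nonoverlapping_attractor G f A"
    and "triangle_property G d"
  shows "\<forall>\<theta>. parameter G \<theta> \<and> filling G f A \<theta> \<longrightarrow> repetitive (balanced_tiling G f A d \<theta>)"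
proof (intro allI impI)
  fix \<theta>
  assume \<theta>: "parameter G \<theta> \<and> filling G f A \<theta>"
  interpret fin_digraph G
    using assms(1) by (simp add: similarity_gifs_def gifs_def)
  interpret parametrized_gifs G f A s d \<theta>
    using assms \<theta> by unfold_locales auto
  show "repetitive (balanced_tiling G f A d \<theta>)"
    using repetitive_balanced assms(4) \<theta> by blast
qed

end
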